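(* Let $G$ be an infinite group. The following conditions are equivalent: (i) $G$ is Abelian; (ii) $p^G=\{p\}$ for each $p\in G^\ast$; (iii) the coarse space $\stackrel{\leftrightarrow}{G}$ is discrete.
   Context: A coarse structure on a set $X$ is a family $\mathcal{E}$ of subsets of $X\times X$ such that: each $E\in\mathcal{E}$ contains the diagonal $\Delta_X=\{(x,x):x\in X\}$; if $E,E'\in\mathcal{E}$ then $E\circ E'=\{(x,y):\exists z\,((x,z)\in E,\ (z,y)\in E')\}\in\mathcal{E}$ and $E^{-1}=\{(y,x):(x,y)\in E\}\in\mathcal{E}$; if $E\in\mathcal{E}$ and $\Delta_X\subseteq E'\subseteq E$ then $E'\in\mathcal{E}$. The pair $(X,\mathcal{E})$ is a coarse space. A subfamily $\mathcal{E}'\subseteq\mathcal{E}$ is a base for $\mathcal{E}$ if every $E\in\mathcal{E}$ is contained in some $E'\in\mathcal{E}'$. For $x\in X$ and $A\subseteq X$ put $E[x]=\{y\in X:(x,y)\in E\}$, $E[A]=\bigcup_{a\in A}E[a]$, $E_A[x]=E[x]\cap A$. A subset $B\subseteq X$ is bounded if there are a finite $F\subseteq X$ and $E\in\mathcal{E}$ with $B\subseteq E[F]$. A subset $A\subseteq X$ is discrete if for every $E\in\mathcal{E}$ there is a bounded $B\subseteq X$ such that $E_A[a]=\{a\}$ for each $a\in A\setminus B$. The coarse space $(X,\mathcal{E})$ is discrete if $A=X$ is discrete. For a group $G$ with identity $e$, $x,g\in G$ and $F\subseteq G$, write $x^g=g^{-1}xg$ and $x^F=\{x^y:y\in F\}$.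 $\stackrel{\leftrightarrow}{G}$ denotes the set $G$ endowed with the coarse structure having base $\{\{(x,y)\in G\times G: y\in x^F\}: F\subseteq G \text{ finite},\ e\in F\}$. $G^\ast$ denotes the set of all free (non-principal) ultrafilters on the set $G$. For an ultrafilter $p$ on $G$ and $g\in G$, $p^g=\{g^{-1}Pg:P\in p\}$, and $p^G=\{p^g:g\in G\}$. *)

theory Defs
  imports "HOL-Algebra.Group"
begin

text \<open>
  \<open>E O E'\<close> is \<open>{(x, y). \<exists>z. (x, z) \<in> E \<and> (z, y) \<in> E'}\<close>.
\<close>

definition coarse_structure :: "'a set \<Rightarrow> 'a rel set \<Rightarrow> bool" where
  "coarse_structure X \<E> \<longleftrightarrow>
     (\<forall>E\<in>\<E>. E \<subseteq> X \<times> X \<and> Id_on X \<subseteq> E) \<and>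
     (\<forall>E\<in>\<E>. \<forall>E'\<in>\<E>. E O E' \<in> \<E>) \<and>
     (\<forall>E\<in>\<E>. E\<inverse> \<in> \<E>) \<and>
     (\<forall>E\<in>\<E>. \<forall>E'. Id_on X \<subseteq> E' \<and> E' \<subseteq> E \<longrightarrow> E' \<in> \<E>)"

definition coarse_base :: "'a rel set \<Rightarrow> 'a rel set \<Rightarrow> bool" where
  "coarse_base \<B> \<E> \<longleftrightarrow> \<B> \<subseteq> \<E> \<and> (\<forall>E\<in>\<E>. \<exists>E'\<in>\<B>. E \<subseteq> E')"

text \<open>
  The only candidate for a coarse structure on \<open>X\<close> that has \<open>\<B>\<close> as a base; see
  \<open>coarse_base_unique\<close> below.
\<close>

definition coarse_from_base :: "'a set \<Rightarrow> 'a rel set \<Rightarrow> 'a rel set" where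
  "coarse_from_base X \<B> = {E. Id_on X \<subseteq> E \<and> (\<exists>E'\<in>\<B>. E \<subseteq> E')}"

lemma coarse_base_unique:
  assumes "coarse_structure X \<E>" and "coarse_base \<B> \<E>"
  shows "\<E> = coarse_from_base X \<B>"
proof (intro equalityI subsetI)
  fix E assume "E \<in> \<E>"
  then have "Id_on X \<subseteq> E" and "\<exists>E'\<in>\<B>. E \<subseteq> E'"
    using assms(1)[unfolded coarse_structure_def, THEN conjunct1]
      assms(2)[unfolded coarse_base_def, THEN conjunct2] by blast+
  then show "E \<in> coarse_from_base X \<B>"
    by (simp add: coarse_from_base_def)
next
  fix E assume "E \<in> coarse_from_base X \<B>"
  then obtain E' where "Id_on X \<subseteq> E" "E' \<in> \<B>" "E \<subseteq> E'"
    unfolding coarse_from_base_def by blast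
  moreover from this have "E' \<in> \<E>"
    using assms(2) unfolding coarse_base_def by blast
  moreover have "\<forall>D\<in>\<E>. \<forall>E. Id_on X \<subseteq> E \<and> E \<subseteq> D \<longrightarrow> E \<in> \<E>"
    using assms(1) unfolding coarse_structure_def by (elim conjE)
  ultimately show "E \<in> \<E>" by blast
qed

definition coarse_bounded :: "'a set \<Rightarrow> 'a rel set \<Rightarrow> 'a set \<Rightarrow> bool" where
  "coarse_bounded X \<E> B \<longleftrightarrow> B \<subseteq> X \<and> (\<exists>F E. finite F \<and> F \<subseteq> X \<and> E \<in> \<E> \<and> B \<subseteq> E `` F)"

definition discrete_subset :: "'a set \<Rightarrow> 'a rel set \<Rightarrow> 'a set \<Rightarrow> bool" where
  "discrete_subset X \<E> A \<longleftrightarrow> A \<subseteq> X \<and>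
     (\<forall>E\<in>\<E>. \<exists>B. coarse_bounded X \<E> B \<and> (\<forall>a\<in>A - B. E `` {a} \<inter> A = {a}))"

definition discrete_coarse_space :: "'a set \<Rightarrow> 'a rel set \<Rightarrow> bool" where
  "discrete_coarse_space X \<E> \<longleftrightarrow> discrete_subset X \<E> X"

definition conj_elt :: "('a, 'm) monoid_scheme \<Rightarrow> 'a \<Rightarrow> 'a \<Rightarrow> 'a" where
  "conj_elt G x g = inv\<^bsub>G\<^esub> g \<otimes>\<^bsub>G\<^esub> x \<otimes>\<^bsub>G\<^esub> g"

definition conj_entourage :: "('a, 'm) monoid_scheme \<Rightarrow> 'a set \<Rightarrow> 'a rel" where
  "conj_entourage G F =
     {(x, y). x \<in> carrier G \<and> y \<in> carrier G \<and> y \<in> conj_elt G x ` F}"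

definition conj_base :: "('a, 'm) monoid_scheme \<Rightarrow> 'a rel set" where
  "conj_base G =
     {conj_entourage G F | F. finite F \<and> F \<subseteq> carrier G \<and> \<one>\<^bsub>G\<^esub> \<in> F}"

definition conj_coarse :: "('a, 'm) monoid_scheme \<Rightarrow> 'a rel set" where
  "conj_coarse G = coarse_from_base (carrier G) (conj_base G)"

context group
begin

lemma conj_elt_closed [simp]:
  "x \<in> carrier G \<Longrightarrow> g \<in> carrier G \<Longrightarrow> conj_elt G x g \<in> carrier G"
  by (simp add: conj_elt_def)

lemma conj_elt_one [simp]: "x \<in> carrier G \<Longrightarrow> conj_elt G x \<one> = x"
  by (simp add: conj_elt_def)

lemma conj_elt_mult:
  "x \<in> carrier G \<Longrightarrow> g \<in> carrier G \<Longrightarrow> h \<in> carrier G \<Longrightarrow>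
     conj_elt G (conj_elt G x g) h = conj_elt G x (g \<otimes> h)"
  by (simp add: conj_elt_def inv_mult_group m_assoc)

lemma conj_base_reflexive:
  assumes "E \<in> conj_base G" shows "E \<subseteq> carrier G \<times> carrier G \<and> Id_on (carrier G) \<subseteq> E"
proof -
  obtain F where F: "\<one> \<in> F"
    "E = conj_entourage G F"
    using assms unfolding conj_base_def by blast
  have "(x, x) \<in> E" if "x \<in> carrier G" for x
    using that F image_eqI[of x "conj_elt G x" \<one> F] by (simp add: conj_entourage_def)
  then show ?thesis using F(2) by (auto simp: conj_entourage_def)
qed

lemma conj_base_comp:
  assumes "E1 \<in> conj_base G" "E2 \<in> conj_base G"
  shows "\<exists>E\<in>conj_base G. E1 O E2 \<subseteq> E"
proof -
  obtain F1 where F1: "finite F1" "F1 \<subseteq> carrier G" "\<one> \<in> F1"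
    "E1 = conj_entourage G F1"
    using assms(1) unfolding conj_base_def by blast
  obtain F2 where F2: "finite F2" "F2 \<subseteq> carrier G" "\<one> \<in> F2"
    "E2 = conj_entourage G F2"
    using assms(2) unfolding conj_base_def by blast
  define F where "F = (\<lambda>(g, h). g \<otimes> h) ` (F1 \<times> F2)"
  define E where "E = conj_entourage G F"
  have "finite F" using F1(1) F2(1) by (simp add: F_def)
  moreover have "F \<subseteq> carrier G" using F1(2) F2(2) by (auto simp: F_def)
  moreover have "\<one> \<in> F"
    unfolding F_def using F1(3) F2(3) by (intro image_eqI[of _ _ "(\<one>, \<one>)"]) auto
  ultimately have "E \<in> conj_base G" unfolding conj_base_def E_def by blast
  moreover have "E1 O E2 \<subseteq> E"
  proof clarify
    fix x y z assume "(x, y) \<in> E1" "(y, z) \<in> E2"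
    then obtain g h where gh: "x \<in> carrier G" "z \<in> carrier G" "g \<in> F1" "h \<in> F2"
      "y = conj_elt G x g" "z = conj_elt G y h"
      unfolding F1(4) F2(4) conj_entourage_def by blast
    then have "z = conj_elt G x (g \<otimes> h)"
      using F1(2) F2(2) by (simp add: conj_elt_mult subset_iff)
    moreover have "g \<otimes> h \<in> F" using gh by (auto simp: F_def)
    ultimately show "(x, z) \<in> E" using gh by (simp add: E_def conj_entourage_def)
  qed
  ultimately show ?thesis by blast
qed

lemma conj_base_converse:
  assumes "E1 \<in> conj_base G"
  shows "\<exists>E\<in>conj_base G. E1\<inverse> \<subseteq> E"
proof -
  obtain F1 where F1: "finite F1" "F1 \<subseteq> carrier G" "\<one> \<in> F1"
    "E1 = conj_entourage G F1"
    using assms unfolding conj_base_def by blast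
  define F where "F = (\<lambda>g. inv g) ` F1"
  define E where "E = conj_entourage G F"
  have "finite F" using F1(1) by (simp add: F_def)
  moreover have "F \<subseteq> carrier G" using F1(2) by (auto simp: F_def)
  moreover have "\<one> \<in> F"
    unfolding F_def using F1(3) by (intro image_eqI[of _ _ \<one>]) auto
  ultimately have "E \<in> conj_base G" unfolding conj_base_def E_def by blast
  moreover have "E1\<inverse> \<subseteq> E"
  proof clarify
    fix x y assume "(y, x) \<in> E1"
    then obtain g where g: "x \<in> carrier G" "y \<in> carrier G" "g \<in> F1" "x = conj_elt G y g"
      unfolding F1(4) conj_entourage_def by blast
    then have "y = conj_elt G x (inv g)"
      using F1(2) by (simp add: conj_elt_mult subset_iff)
    moreover have "inv g \<in> F" using g by (auto simp: F_def)
    ultimately show "(x, y) \<in> E" using g by (simp add: E_def conj_entourage_def)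
  qed
  ultimately show ?thesis by blast
qed

lemma conj_coarse_base: "coarse_base (conj_base G) (conj_coarse G)"
  using conj_base_reflexive
  unfolding coarse_base_def conj_coarse_def coarse_from_base_def by blast

lemma conj_coarse_structure: "coarse_structure (carrier G) (conj_coarse G)"
  unfolding coarse_structure_def
proof (intro conjI ballI allI impI)
  fix E assume E: "E \<in> conj_coarse G"
  then obtain D where D: "Id_on (carrier G) \<subseteq> E" "D \<in> conj_base G" "E \<subseteq> D"
    unfolding conj_coarse_def coarse_from_base_def by blast
  show "Id_on (carrier G) \<subseteq> E" by fact
  show "E \<subseteq> carrier G \<times> carrier G" using D conj_base_reflexive by blast
  obtain C where "C \<in> conj_base G" "D\<inverse> \<subseteq> C" using conj_base_converse[OF D(2)] by blast
  then show "E\<inverse> \<in> conj_coarse G"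
    using D unfolding conj_coarse_def coarse_from_base_def by blast
  show "E' \<in> conj_coarse G" if "Id_on (carrier G) \<subseteq> E' \<and> E' \<subseteq> E" for E'
    using that D unfolding conj_coarse_def coarse_from_base_def by blast
  show "E O E' \<in> conj_coarse G" if E': "E' \<in> conj_coarse G" for E'
  proof -
    obtain D' where D': "Id_on (carrier G) \<subseteq> E'" "D' \<in> conj_base G" "E' \<subseteq> D'"
      using E' unfolding conj_coarse_def coarse_from_base_def by blast
    obtain C where "C \<in> conj_base G" "D O D' \<subseteq> C"
      using conj_base_comp[OF D(2) D'(2)] by blast
    moreover have "E O E' \<subseteq> D O D'" using D D' by blast
    moreover have "Id_on (carrier G) \<subseteq> E O E'" using D(1) D'(1) by blast
    ultimately show ?thesis
      unfolding conj_coarse_def coarse_from_base_def by blast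
  qed
qed

end

text \<open>
  Ultrafilters on \<open>X\<close> are families of subsets of \<open>X\<close>, so that conjugation acts on them memberwise.
\<close>

definition ultrafilter_on :: "'a set \<Rightarrow> 'a set set \<Rightarrow> bool" where
  "ultrafilter_on X p \<longleftrightarrow>
     p \<subseteq> Pow X \<and> X \<in> p \<and> {} \<notin> p \<and>
     (\<forall>A\<in>p. \<forall>B\<in>p. A \<inter> B \<in> p) \<and>
     (\<forall>A\<in>p. \<forall>B. A \<subseteq> B \<and> B \<subseteq> X \<longrightarrow> B \<in> p) \<and>
     (\<forall>A. A \<subseteq> X \<longrightarrow> A \<in> p \<or> X - A \<in> p)"

definition principal_ultrafilter :: "'a set \<Rightarrow> 'a \<Rightarrow> 'a set set" where
  "principal_ultrafilter X x = {A. A \<subseteq> X \<and> x \<in> A}"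

definition free_ultrafilters :: "'a set \<Rightarrow> 'a set set set" where
  "free_ultrafilters X =
     {p. ultrafilter_on X p \<and> (\<forall>x\<in>X. p \<noteq> principal_ultrafilter X x)}"

definition conj_ultrafilter :: "('a, 'm) monoid_scheme \<Rightarrow> 'a set set \<Rightarrow> 'a \<Rightarrow> 'a set set" where
  "conj_ultrafilter G p g = (\<lambda>P. (\<lambda>x. conj_elt G x g) ` P) ` p"

definition conj_orbit :: "('a, 'm) monoid_scheme \<Rightarrow> 'a set set \<Rightarrow> 'a set set set" where
  "conj_orbit G p = conj_ultrafilter G p ` carrier G"

end

theory Submission
  imports Defs
begin

text \<open>
  In a non-abelian infinite group some conjugation by \<open>g\<close> moves infinitely many elements, since
  a coset of the centralizer of \<open>g\<close> consists of moved elements. Bounded sets are finite, so this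
  contradicts discreteness. Moreover an injection that moves infinitely many points maps some
  infinite set \<open>P\<close> to a set disjoint from \<open>P\<close>, so conjugation by \<open>g\<close> moves every free
  ultrafilter containing \<open>P\<close>.
\<close>

section \<open>Infinite sets disjoint from their image\<close>

lemma ex_infinite_disjoint_image:
  assumes inj: "inj_on f M" and inf: "infinite M" and moved: "\<And>x. x \<in> M \<Longrightarrow> f x \<noteq> x"
  shows "\<exists>P\<subseteq>M. infinite P \<and> P \<inter> f ` P = {}"
proof -
  let ?A = "{P. P \<subseteq> M \<and> P \<inter> f ` P = {}}"
  \<comment> \<open>Zorn applies because disjointness of a set from its image is a condition on
    pairs of its points, and two points of the union of a chain already lie in one member.\<close>
  have "\<exists>P\<in>?A. \<forall>Q\<in>?A. P \<subseteq> Q \<longrightarrow> Q = P"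
  proof (rule subset_Zorn')
    fix C assume C: "subset.chain ?A C"
    have sub: "C \<subseteq> ?A" and lin: "\<And>S T. S \<in> C \<Longrightarrow> T \<in> C \<Longrightarrow> S \<subseteq> T \<or> T \<subseteq> S"
      using C by (auto simp: subset_chain_def)
    have "f y \<noteq> x" if xy: "x \<in> \<Union>C" "y \<in> \<Union>C" for x y
    proof -
      obtain S T where "S \<in> C" "T \<in> C" "x \<in> S" "y \<in> T" using xy by blast
      then obtain U where "U \<in> C" "x \<in> U" "y \<in> U" using lin by blast
      then show ?thesis using sub by blast
    qed
    then show "\<Union>C \<in> ?A" using sub by blast
  qed
  then obtain P where "P \<in> ?A" and max: "\<forall>Q\<in>?A. P \<subseteq> Q \<longrightarrow> Q = P"
    by (rule bexE)
  then have P: "P \<subseteq> M" "P \<inter> f ` P = {}" by simp_all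
  have "infinite P"
  proof
    \<comment> \<open>A point of \<open>M\<close> can fail to extend \<open>P\<close> only if it
      lies in \<open>P\<close> or its image, or is sent into \<open>P\<close>. For finite
      \<open>P\<close> these are finitely many points, the last kind by injectivity, so some other
      \<open>x\<close> extends \<open>P\<close>.\<close>
    assume fin: "finite P"
    have "finite (M \<inter> f -` P)"
      using finite_vimage_IntI[OF fin inj] by (simp add: Int_commute)
    then have "finite (P \<union> f ` P \<union> (M \<inter> f -` P))" using fin by simp
    then have "infinite (M - (P \<union> f ` P \<union> (M \<inter> f -` P)))"
      using inf by (rule Diff_infinite_finite)
    then obtain x where x: "x \<in> M" "x \<notin> P" "x \<notin> f ` P" "f x \<notin> P"
      using infinite_imp_nonempty by blast
    then have "insert x P \<inter> f ` insert x P = {}" using P moved[of x] by auto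
    then have "insert x P = P" using bspec[OF max, of "insert x P"] P(1) x(1) by blast
    then show False using x(2) by blast
  qed
  then show ?thesis using P by blast
qed

section \<open>Existence of free ultrafilters\<close>

text \<open>
  Zorn's lemma is applied to filters without finite members: if neither \<open>A\<close> nor \<open>X - A\<close> can be
  added, then each of them meets some member in a finite set, and so the intersection of two
  members is finite.
\<close>

lemma ex_free_ultrafilter:
  assumes "infinite P" and "P \<subseteq> X"
  shows "\<exists>p\<in>free_ultrafilters X. P \<in> p"
proof -
  \<comment> \<open>Infinite members make the filter proper, and in the end exclude principal
    ultrafilters, which contain a singleton.\<close>
  define filt where "filt F \<longleftrightarrow> F \<subseteq> Pow X \<and> P \<in> F \<and> (\<forall>A\<in>F. infinite A) \<and>
    (\<forall>A\<in>F. \<forall>B\<in>F. A \<inter> B \<in> F) \<and> (\<forall>A\<in>F. \<forall>B. A \<subseteq> B \<and> B \<subseteq> X \<longrightarrow> B \<in> F)" for F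
  have filtI: "filt F"
    if "F \<subseteq> Pow X" "P \<in> F" "\<And>A. A \<in> F \<Longrightarrow> infinite A"
      "\<And>A B. A \<in> F \<Longrightarrow> B \<in> F \<Longrightarrow> A \<inter> B \<in> F"
      "\<And>A B. A \<in> F \<Longrightarrow> A \<subseteq> B \<Longrightarrow> B \<subseteq> X \<Longrightarrow> B \<in> F" for F
    unfolding filt_def
  proof (intro conjI ballI allI impI)
    show "B \<in> F" if "A \<in> F" "A \<subseteq> B \<and> B \<subseteq> X" for A B
      using that \<open>\<And>A B. A \<in> F \<Longrightarrow> A \<subseteq> B \<Longrightarrow> B \<subseteq> X \<Longrightarrow> B \<in> F\<close> by blast
  qed (fact that)+
  have filtD: "F \<subseteq> Pow X" "P \<in> F" "\<And>A. A \<in> F \<Longrightarrow> infinite A"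
      "\<And>A B. A \<in> F \<Longrightarrow> B \<in> F \<Longrightarrow> A \<inter> B \<in> F"
      "\<And>A B. A \<in> F \<Longrightarrow> A \<subseteq> B \<Longrightarrow> B \<subseteq> X \<Longrightarrow> B \<in> F" if "filt F" for F
    using that by (simp_all add: filt_def)
  have "\<exists>F\<in>Collect filt. \<forall>F'\<in>Collect filt. F \<subseteq> F' \<longrightarrow> F' = F"
  proof (rule subset_Zorn_nonempty)
    \<comment> \<open>Zorn needs a starting filter here: the union of the empty chain would not
      contain \<open>P\<close>.\<close>
    have "filt {A. P \<subseteq> A \<and> A \<subseteq> X}"
      using assms by (intro filtI) (auto dest: finite_subset)
    then show "Collect filt \<noteq> {}" by blast
  next
    fix C assume "C \<noteq> {}" and C: "subset.chain (Collect filt) C"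
    have sub: "\<And>F. F \<in> C \<Longrightarrow> filt F"
      and lin: "\<And>S T. S \<in> C \<Longrightarrow> T \<in> C \<Longrightarrow> S \<subseteq> T \<or> T \<subseteq> S"
      using C by (auto simp: subset_chain_def)
    have "filt (\<Union>C)"
    proof (rule filtI)
      show "\<Union>C \<subseteq> Pow X" using filtD(1)[OF sub] by blast
      show "P \<in> \<Union>C" using filtD(2)[OF sub] \<open>C \<noteq> {}\<close> by blast
      show "infinite A" if "A \<in> \<Union>C" for A using that filtD(3)[OF sub] by blast
      show "B \<in> \<Union>C" if "A \<in> \<Union>C" "A \<subseteq> B" "B \<subseteq> X" for A B
        using that filtD(5)[OF sub] by blast
      show "A \<inter> B \<in> \<Union>C" if AB: "A \<in> \<Union>C" "B \<in> \<Union>C" for A B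
      proof -
        obtain S T where "S \<in> C" "T \<in> C" "A \<in> S" "B \<in> T" using AB by blast
        then obtain U where "U \<in> C" "A \<in> U" "B \<in> U" using lin by blast
        then show ?thesis using filtD(4)[OF sub] by blast
      qed
    qed
    then show "\<Union>C \<in> Collect filt" by blast
  qed
  then obtain p where "p \<in> Collect filt"
    and "\<forall>F\<in>Collect filt. p \<subseteq> F \<longrightarrow> F = p"
    by (rule bexE)
  then have p: "filt p" and max: "\<And>F. filt F \<Longrightarrow> p \<subseteq> F \<Longrightarrow> F = p" by simp_all
  note pD = filtD[OF p]
  have extend: "A \<in> p" if A: "A \<subseteq> X" and meets: "\<And>B. B \<in> p \<Longrightarrow> infinite (A \<inter> B)" for A
  proof -
    \<comment> \<open>This is the filter generated by \<open>p\<close> and \<open>A\<close>. By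
      \<open>meets\<close> its members are infinite, so maximality identifies it with
      \<open>p\<close>.\<close>
    let ?F = "{D. D \<subseteq> X \<and> (\<exists>B\<in>p. A \<inter> B \<subseteq> D)}"
    have sub: "p \<subseteq> ?F" using pD(1) by blast
    have "filt ?F"
    proof (rule filtI)
      show "infinite D" if "D \<in> ?F" for D
        using that meets finite_subset by blast
      show "D \<inter> E \<in> ?F" if DE: "D \<in> ?F" "E \<in> ?F" for D E
      proof -
        obtain B B' where "B \<in> p" "B' \<in> p" "A \<inter> B \<subseteq> D" "A \<inter> B' \<subseteq> E" using DE by blast
        then have "B \<inter> B' \<in> p" "A \<inter> (B \<inter> B') \<subseteq> D \<inter> E" using pD(4) by auto
        then show ?thesis using DE by blast
      qed
    qed (use sub pD(2) in blast)+
    then have "?F = p" using sub by (rule max)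
    moreover have "A \<in> ?F" using A pD(2) by blast
    ultimately show ?thesis by simp
  qed
  have dich: "A \<in> p \<or> X - A \<in> p" if A: "A \<subseteq> X" for A
  proof (rule ccontr)
    assume "\<not> (A \<in> p \<or> X - A \<in> p)"
    then obtain B B' where B: "B \<in> p" "B' \<in> p" "finite (A \<inter> B)" "finite ((X - A) \<inter> B')"
      using extend[OF A] extend[OF Diff_subset] by metis
    have "B \<inter> B' \<subseteq> (A \<inter> B) \<union> ((X - A) \<inter> B')" using B(1) pD(1) by blast
    then have "finite (B \<inter> B')" using B(3,4) by (meson finite_Un finite_subset)
    then show False using pD(3) pD(4)[OF B(1,2)] by simp
  qed
  have "X \<in> p" using pD(5)[OF pD(2) assms(2)] by simp
  moreover have "{} \<notin> p" using pD(3) by blast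
  ultimately have "ultrafilter_on X p"
    unfolding ultrafilter_on_def using pD(1,4,5) dich by simp
  moreover have "p \<noteq> principal_ultrafilter X x" if "x \<in> X" for x
    using pD(3)[of "{x}"] that by (auto simp: principal_ultrafilter_def)
  ultimately show ?thesis using pD(2) by (auto simp: free_ultrafilters_def)
qed

section \<open>Elements moved by conjugation\<close>

context group
begin

text \<open>With \<open>y = x\<close> this identifies the fixed points of conjugation by
  \<open>g\<close> with the centralizer of \<open>g\<close>.\<close>

lemma conj_elt_eq_iff:
  assumes "x \<in> carrier G" "y \<in> carrier G" "g \<in> carrier G"
  shows "conj_elt G x g = y \<longleftrightarrow> x \<otimes> g = g \<otimes> y"
  using assms by (simp add: conj_elt_def m_assoc inv_solve_left')

lemma inj_on_conj_elt:
  assumes "g \<in> carrier G"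
  shows "inj_on (\<lambda>x. conj_elt G x g) (carrier G)"
  using assms by (auto simp: inj_on_def conj_elt_def)

lemma conj_elt_comm:
  assumes "comm_group G" "x \<in> carrier G" "g \<in> carrier G"
  shows "conj_elt G x g = x"
  using assms by (simp add: conj_elt_eq_iff comm_monoid.m_comm comm_group.axioms)

text \<open>Left translation by an element not commuting with \<open>g\<close> injects the
  centralizer of \<open>g\<close> into the set of moved elements. If the latter were finite, both
  sets would be, and so would the group.\<close>

lemma infinite_moved_by_conj:
  assumes "infinite (carrier G)" and "\<not> comm_group G"
  shows "\<exists>g\<in>carrier G. infinite {x \<in> carrier G. conj_elt G x g \<noteq> x}"
proof -
  obtain x g where x: "x \<in> carrier G" and g: "g \<in> carrier G" and xg: "x \<otimes> g \<noteq> g \<otimes> x"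
    using assms(2) group_comm_groupI by blast
  define M where "M = {x \<in> carrier G. conj_elt G x g \<noteq> x}"
  have M: "M = {x \<in> carrier G. x \<otimes> g \<noteq> g \<otimes> x}"
    using g by (auto simp: M_def conj_elt_eq_iff)
  have "infinite M"
  proof
    assume fin: "finite M"
    have "(\<lambda>c. x \<otimes> c) ` (carrier G - M) \<subseteq> M"
    proof clarify
      fix c assume c: "c \<in> carrier G" "c \<notin> M"
      then have "c \<otimes> g = g \<otimes> c" by (simp add: M)
      \<comment> \<open>Moving \<open>c\<close> to the right end allows it to be cancelled, which
        leaves \<open>x \<otimes> g\<close> against \<open>g \<otimes> x\<close>.\<close>
      then have "(x \<otimes> c) \<otimes> g = (x \<otimes> g) \<otimes> c" using c x g by (simp add: m_assoc)
      also have "\<dots> \<noteq> (g \<otimes> x) \<otimes> c" using c x g xg by simp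
      finally show "x \<otimes> c \<in> M" using c x g by (simp add: M m_assoc)
    qed
    moreover have "inj_on (\<lambda>c. x \<otimes> c) (carrier G - M)"
      using x by (auto simp: inj_on_def)
    ultimately have "finite (carrier G - M)"
      using fin by (meson inj_on_finite)
    then show False using fin assms(1) Diff_infinite_finite by blast
  qed
  then show ?thesis using g M_def by blast
qed

section \<open>Orbits of ultrafilters\<close>

lemma conj_orbit_comm:
  assumes "comm_group G" and "p \<subseteq> Pow (carrier G)"
  shows "conj_orbit G p = {p}"
proof -
  have "(\<lambda>x. conj_elt G x g) ` P = P" if "P \<in> p" "g \<in> carrier G" for P g
  proof -
    have "(\<lambda>x. conj_elt G x g) ` P = (\<lambda>x. x) ` P"
      using that assms by (intro image_cong) (auto intro!: conj_elt_comm)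
    then show ?thesis by simp
  qed
  then have "conj_ultrafilter G p g = p" if "g \<in> carrier G" for g
    using that by (simp add: conj_ultrafilter_def)
  \<comment> \<open>The identity shows that the orbit is nonempty, so it is \<open>{p}\<close> and
    not \<open>{}\<close>.\<close>
  then show ?thesis unfolding conj_orbit_def using one_closed by auto
qed

lemma ex_free_ultrafilter_moved_by_conj:
  assumes "infinite (carrier G)" and "\<not> comm_group G"
  shows "\<exists>p\<in>free_ultrafilters (carrier G). conj_orbit G p \<noteq> {p}"
proof -
  obtain g where g: "g \<in> carrier G" and inf: "infinite {x \<in> carrier G. conj_elt G x g \<noteq> x}"
    using infinite_moved_by_conj[OF assms] by blast
  have "inj_on (\<lambda>x. conj_elt G x g) {x \<in> carrier G. conj_elt G x g \<noteq> x}"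
    using inj_on_conj_elt[OF g] by (rule inj_on_subset) blast
  from ex_infinite_disjoint_image[OF this inf]
  obtain P where P: "P \<subseteq> carrier G" "infinite P" "P \<inter> (\<lambda>x. conj_elt G x g) ` P = {}"
    by blast
  obtain p where p: "p \<in> free_ultrafilters (carrier G)" "P \<in> p"
    using ex_free_ultrafilter P by blast
  have "conj_orbit G p \<noteq> {p}"
  \<comment> \<open>A trivial orbit would put both \<open>P\<close> and its conjugate by
    \<open>g\<close> into \<open>p\<close>, although they are disjoint.\<close>
  proof
    assume "conj_orbit G p = {p}"
    then have "conj_ultrafilter G p g = p" using g by (auto simp: conj_orbit_def)
    then have "(\<lambda>x. conj_elt G x g) ` P \<in> p" using p by (auto simp: conj_ultrafilter_def)
    moreover have "A \<inter> B \<in> p" if "A \<in> p" "B \<in> p" for A B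
      using p(1) that by (simp add: free_ultrafilters_def ultrafilter_on_def)
    ultimately have "{} \<in> p" using p(2) P(3) by metis
    then show False using p(1) by (simp add: free_ultrafilters_def ultrafilter_on_def)
  qed
  then show ?thesis using p by blast
qed

section \<open>Bounded sets and discreteness\<close>

lemma finite_conj_coarse_bounded:
  assumes "coarse_bounded (carrier G) (conj_coarse G) B"
  shows "finite B"
proof -
  obtain K E where K: "finite K" "E \<in> conj_coarse G" "B \<subseteq> E `` K"
    using assms unfolding coarse_bounded_def by blast
  then obtain F where F: "finite F" "E \<subseteq> conj_entourage G F"
    unfolding conj_coarse_def coarse_from_base_def conj_base_def by blast
  \<comment> \<open>Each point of \<open>K\<close> contributes at most its conjugates by the finite
    set \<open>F\<close>.\<close>
  then have "B \<subseteq> (\<Union>x\<in>K. conj_elt G x ` F)"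
    using K by (fastforce simp: conj_entourage_def)
  then show ?thesis using K(1) F(1) by (meson finite_UN finite_imageI finite_subset)
qed

lemma discrete_conj_coarse_comm:
  assumes "comm_group G"
  shows "discrete_coarse_space (carrier G) (conj_coarse G)"
  unfolding discrete_coarse_space_def discrete_subset_def
proof (intro conjI ballI)
  fix E assume E: "E \<in> conj_coarse G"
  \<comment> \<open>In an abelian group every entourage is the diagonal, so the exceptional bounded
    set can be empty.\<close>
  have "coarse_bounded (carrier G) (conj_coarse G) {}"
    using E unfolding coarse_bounded_def by blast
  moreover have "E `` {a} \<inter> carrier G = {a}" if a: "a \<in> carrier G" for a
  proof -
    obtain F where F: "Id_on (carrier G) \<subseteq> E" "F \<subseteq> carrier G" "E \<subseteq> conj_entourage G F"
      using E unfolding conj_coarse_def coarse_from_base_def conj_base_def by blast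
    have "b = a" if "(a, b) \<in> E" for b
    proof -
      have "b \<in> conj_elt G a ` F" using that F(3) by (auto simp: conj_entourage_def)
      then show ?thesis using F(2) conj_elt_comm[OF assms a] by auto
    qed
    moreover have "(a, a) \<in> E" using F a by blast
    ultimately show ?thesis using a by blast
  qed
  ultimately show "\<exists>B. coarse_bounded (carrier G) (conj_coarse G) B \<and>
      (\<forall>a\<in>carrier G - B. E `` {a} \<inter> carrier G = {a})"
    by blast
qed simp

lemma comm_if_discrete_conj_coarse:
  assumes "infinite (carrier G)" and "discrete_coarse_space (carrier G) (conj_coarse G)"
  shows "comm_group G"
proof (rule ccontr)
  assume "\<not> comm_group G"
  then obtain g where g: "g \<in> carrier G"
    and inf: "infinite {x \<in> carrier G. conj_elt G x g \<noteq> x}"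
    using infinite_moved_by_conj[OF assms(1)] by blast
  \<comment> \<open>This entourage relates every element to its conjugate by \<open>g\<close>, so
    discreteness confines the moved elements to a bounded, hence finite, set.\<close>
  let ?E = "conj_entourage G {\<one>, g}"
  have "?E \<in> conj_base G" unfolding conj_base_def using g by blast
  then have "?E \<in> conj_coarse G"
    using conj_coarse_base unfolding coarse_base_def by blast
  with assms(2) have "\<exists>B. coarse_bounded (carrier G) (conj_coarse G) B \<and>
      (\<forall>a\<in>carrier G - B. ?E `` {a} \<inter> carrier G = {a})"
    unfolding discrete_coarse_space_def discrete_subset_def by (elim conjE) (rule bspec)
  then obtain B where B: "coarse_bounded (carrier G) (conj_coarse G) B"
    and disc: "\<forall>a\<in>carrier G - B. ?E `` {a} \<inter> carrier G = {a}"
    by (elim exE conjE)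
  have "conj_elt G x g = x" if "x \<in> carrier G - B" for x
  proof -
    have "conj_elt G x g \<in> ?E `` {x} \<inter> carrier G"
      using that g by (auto simp: conj_entourage_def)
    then show ?thesis using bspec[OF disc that] by blast
  qed
  then have "{x \<in> carrier G. conj_elt G x g \<noteq> x} \<subseteq> B" by blast
  then show False using inf finite_conj_coarse_bounded[OF B] finite_subset by blast
qed

end

theorem theorem1:
  fixes G :: "('a, 'm) monoid_scheme"
  assumes "group G" and "infinite (carrier G)"
  shows "(comm_group G \<longleftrightarrow> (\<forall>p\<in>free_ultrafilters (carrier G). conj_orbit G p = {p})) \<and>
         (comm_group G \<longleftrightarrow> discrete_coarse_space (carrier G) (conj_coarse G))"
proof -
  interpret group G by fact
  have "conj_orbit G p = {p}" if "comm_group G" "p \<in> free_ultrafilters (carrier G)" for p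
    using that conj_orbit_comm by (simp add: free_ultrafilters_def ultrafilter_on_def)
  \<comment> \<open>Used contrapositively: if all free ultrafilters have trivial orbits, the group
    is abelian.\<close>
  moreover note ex_free_ultrafilter_moved_by_conj[OF assms(2)]
  moreover note discrete_conj_coarse_comm comm_if_discrete_conj_coarse[OF assms(2)]
  ultimately show ?thesis by metis
qed

end
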